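(* Let $G$ be a graph. Let $\tau:V(G)\to\mathbb{N}_0$ be a threshold function for $G$ with $\tau(u)\le d_G(u)$ and $\tau(u)\in\{0,1,d_G(u)\}$ for every vertex $u$ of $G$, and such that $G$ has no edge $uv$ with $\tau(u)=d_G(u)$ and $\tau(v)=d_G(v)$. A set $X$ of vertices of $G$ is a non-monotone target set for $(G,\tau)$ if and only if the following conditions (1) and (2) hold: (1) For every set $U$ that is the vertex set of a connected component of the induced subgraph $G\big[\{u\in V(G):\tau(u)\in\{0,1\}\}\big]$ with $|U|\ge 2$ and $\tau(u)=1$ for every $u\in U$: (a) If $G[U]$ is not bipartite, then $X\cap N_G[U]\neq\emptyset$. (b) If $G[U]$ is bipartite with partite sets $A$ and $B$, and $A'=N_G(B)\setminus N_G[A]$, $B'=N_G(A)\setminus N_G[B]$, and $C=N_G(A)\cap N_G(B)$, then $$X\cap(A\cup A'\cup C)\neq\emptyset\quad\text{and}\quad X\cap(B\cup B'\cup C)\neq\emptyset.$$ (2) If $u$ is a vertex with $\tau(u)=1$ such that $\tau(v)=d_G(v)$ for every $v\in N_G(u)$, then there are two (not necessarily distinct) neighbors $v_1$ and $v_2$ of $u$ such that $v_1\in X$ and $N_G(v_2)\subseteq X$.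
   Context: Graphs are finite, simple, and undirected. $\mathbb{N}=\{1,2,3,\ldots\}$ and $\mathbb{N}_0=\{0,1,2,\ldots\}$. $d_G(u)$ is the degree of $u$ in $G$ and $N_G(u)$ is the set of neighbors of $u$. For a set $Y$ of vertices of $G$, $N_G(Y)=\left(\bigcup_{u\in Y}N_G(u)\right)\setminus Y$ and $N_G[Y]=Y\cup N_G(Y)$. $G[Y]$ is the subgraph of $G$ induced by $Y$. A threshold function for $G$ is a function $\tau:V(G)\to\mathbb{N}_0$. For $X\subseteq V(G)$, the non-monotone activation process on $(G,\tau)$ starting with $X$ is the sequence $(X_t)_{t\in\mathbb{N}_0}$ with $X_0=X$ and $X_t=\{u\in V(G):|N_G(u)\cap X_{t-1}|\ge\tau(u)\}$ for every $t\in\mathbb{N}$. The set $X$ is a non-monotone target set for $(G,\tau)$ if there is some $t_0\in\mathbb{N}_0$ such that $X_t=V(G)$ for every $t\ge t_0$. *)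

theory Defs
  imports "Graph_Theory.Digraph_Component"
begin

text \<open>
  Finite simple undirected graphs are represented by the locale \<^locale>\<open>graph\<close>: finite symmetric
  digraphs without loops and parallel arcs. An edge is a pair of opposite arcs, so the degree of a
  vertex is its \<^const>\<open>out_degree\<close>.
\<close>

definition nbhd :: "('a,'b) pre_digraph \<Rightarrow> 'a \<Rightarrow> 'a set" where
  "nbhd G u = {v. u \<rightarrow>\<^bsub>G\<^esub> v}"

definition open_nbhd :: "('a,'b) pre_digraph \<Rightarrow> 'a set \<Rightarrow> 'a set" where
  "open_nbhd G Y = (\<Union>u\<in>Y. nbhd G u) - Y"

definition closed_nbhd :: "('a,'b) pre_digraph \<Rightarrow> 'a set \<Rightarrow> 'a set" where
  "closed_nbhd G Y = Y \<union> open_nbhd G Y"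

text \<open>Vertex sets of the connected components, i.e. of the maximal connected subgraphs.\<close>

definition component_verts :: "('a,'b) pre_digraph \<Rightarrow> 'a set set" where
  "component_verts G = {verts H | H. pre_digraph.max_subgraph G connected H}"

definition partite_sets :: "('a,'b) pre_digraph \<Rightarrow> 'a set \<Rightarrow> 'a set \<Rightarrow> bool" where
  "partite_sets G A B \<longleftrightarrow> A \<union> B = verts G \<and> A \<inter> B = {} \<and>
     (\<forall>u v. u \<rightarrow>\<^bsub>G\<^esub> v \<longrightarrow> (u \<in> A \<and> v \<in> B) \<or> (u \<in> B \<and> v \<in> A))"

definition bipartite :: "('a,'b) pre_digraph \<Rightarrow> bool" where
  "bipartite G \<longleftrightarrow> (\<exists>A B. partite_sets G A B)"

primrec activation :: "('a,'b) pre_digraph \<Rightarrow> ('a \<Rightarrow> nat) \<Rightarrow> 'a set \<Rightarrow> nat \<Rightarrow> 'a set" where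
  "activation G \<tau> X 0 = X"
| "activation G \<tau> X (Suc t) = {u \<in> verts G. card (nbhd G u \<inter> activation G \<tau> X t) \<ge> \<tau> u}"

definition non_monotone_target_set :: "('a,'b) pre_digraph \<Rightarrow> ('a \<Rightarrow> nat) \<Rightarrow> 'a set \<Rightarrow> bool" where
  "non_monotone_target_set G \<tau> X \<longleftrightarrow>
     X \<subseteq> verts G \<and> (\<exists>t\<^sub>0. \<forall>t\<ge>t\<^sub>0. activation G \<tau> X t = verts G)"

end

theory Submission
  imports Defs
begin

text \<open>
  A vertex of threshold 1 is active as soon as one neighbour was active, a vertex \<open>v\<close> of full threshold
  \<open>\<tau> v = d(v)\<close> only if all its neighbours were, and full vertices are pairwise non-adjacent. Hence
  activity in a component \<open>U\<close> of low-threshold vertices, each of which has a neighbour in \<open>U\<close>, recurs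
  with period 2 and spreads along edges with a change of parity. The set of vertices that become
  active at both parities is therefore empty or all of \<open>U\<close>; if it is empty but some vertex of \<open>U\<close>
  ever becomes active, then the vertices active at even and at odd times form a bipartition of \<open>U\<close>,
  which condition (1) excludes. A singleton component has only full neighbours, and a full vertex
  active at time \<open>t\<close> activates its whole neighbourhood at \<open>t + 1\<close> and hence itself at \<open>t + 2\<close>.
  Conversely, inactivity of \<open>A \<union> A' \<union> C\<close> forces inactivity of \<open>B \<union> B' \<union> C\<close> one step later, and vice
  versa.
\<close>

section \<open>Neighbourhoods and components\<close>

text \<open>Induced subgraphs of a symmetric digraph are symmetric, so for them
  \<open>connected\<close> and \<open>strongly_connected\<close> agree. Maximal subgraphs for either
  property are induced, hence the same, and the theory of strong components applies.\<close>

lemma (in sym_digraph) component_verts_eq_reachable: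
  "component_verts G = (\<lambda>u. {v. u \<rightarrow>\<^sup>* v}) ` verts G"
proof -
  have con: "connected H \<longleftrightarrow> strongly_connected H" if H: "induced_subgraph H G" for H
  proof -
    interpret H: sym_digraph H using H by (rule induced_graph_imp_graph)
    show ?thesis
      using H.symmetric_connected_imp_strongly_connected[OF H.sym_arcs]
      by (auto simp: connected_def strongly_connected_def H.reachable_mk_symmetricI)
  qed
  have mono: "arc_mono connected"
    unfolding arc_mono_def
    by (metis spanning_def subgraphE wf_digraph.connected_spanning_imp_connected)
  have "max_subgraph connected H \<longleftrightarrow> max_subgraph strongly_connected H" for H
  proof
    assume L: "max_subgraph connected H"
    have ind: "induced_subgraph H G" using L mono by (rule induced_subgraphI_arc_mono)
    show "max_subgraph strongly_connected H"
    proof (rule max_subgraphI)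
      show "strongly_connected H" using con[OF ind] max_subgraph_prop[OF L] by simp
      show "subgraph H G" using L by (rule subgraphI_max_subgraph)
      fix K assume K: "H \<noteq> K" "subgraph H K" "subgraph K G"
      have "\<not> connected K" using L K unfolding max_subgraph_def by metis
      moreover have "connected K" if "strongly_connected K"
      proof -
        interpret K: wf_digraph K using K by blast
        show ?thesis
          using that by (auto simp: connected_def strongly_connected_def K.reachable_mk_symmetricI)
      qed
      ultimately show "\<not> strongly_connected K" by blast
    qed
  next
    assume R: "max_subgraph strongly_connected H"
    have ind: "induced_subgraph H G"
      using R arc_mono_strongly_connected by (rule induced_subgraphI_arc_mono)
    show "max_subgraph connected H"
    proof (rule max_subgraphI)
      show "connected H" using con[OF ind] max_subgraph_prop[OF R] by simp
      show "subgraph H G" using R by (rule subgraphI_max_subgraph)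
      fix K assume K: "H \<noteq> K" "subgraph H K" "subgraph K G"
      \<comment> \<open>Connectedness passes from \<open>K\<close> to the induced subgraph on its
        vertices, where it means strong connectedness; maximality of \<open>H\<close> then forces
        \<open>?K = H\<close>.\<close>
      let ?K = "G \<restriction> verts K"
      have sub: "verts K \<subseteq> verts G" and K': "subgraph K ?K"
        using K subgraph_induce_subgraphI2 by blast+
      have ind: "induced_subgraph ?K G" using sub by (rule induced_induce)
      show "\<not> connected K"
      proof
        assume "connected K"
        then have "connected ?K" using mono K' unfolding arc_mono_def by (metis induce_subgraph_verts)
        then have "strongly_connected ?K" using con[OF ind] by simp
        moreover have HK: "subgraph H ?K" using K(2) K' by (rule subgraph_trans)
        ultimately have "?K = H"
          using R ind unfolding max_subgraph_def by (blast dest: induced_imp_subgraph)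
        then have "subgraph K H" using K' by simp
        then show False using K(1,2) by (auto simp: subgraph_def compatible_def)
      qed
    qed
  qed
  then have "component_verts G = scc_of ` verts G"
    unfolding component_verts_def sccs_verts_conv_scc_of[symmetric] sccs_verts_conv sccs_altdef2
    by auto
  moreover have "scc_of u = {v. u \<rightarrow>\<^sup>* v}" for u
    unfolding scc_of_def using symmetric_reachable' by blast
  ultimately show ?thesis by simp
qed

section \<open>Neighbourhoods and partite sets in induced subgraphs\<close>

lemma dominates_induce_subgraph_iff:
  "u \<rightarrow>\<^bsub>G \<restriction> S\<^esub> v \<longleftrightarrow> u \<in> S \<and> v \<in> S \<and> v \<in> nbhd G u"
  by (auto simp: nbhd_def arcs_ends_conv image_iff)

lemma closed_nbhd_eq: "closed_nbhd G Y = Y \<union> (\<Union>u\<in>Y. nbhd G u)"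
  by (auto simp: closed_nbhd_def open_nbhd_def)

lemma partite_sets_induced_iff:
  "partite_sets (G \<restriction> U) A B \<longleftrightarrow>
     A \<union> B = U \<and> A \<inter> B = {} \<and> (\<forall>u\<in>A. nbhd G u \<inter> U \<subseteq> B) \<and> (\<forall>u\<in>B. nbhd G u \<inter> U \<subseteq> A)"
  unfolding partite_sets_def dominates_induce_subgraph_iff induce_subgraph_verts by blast

text \<open>In the notation of the theorem, a neighbour of \<open>B\<close> outside \<open>U\<close>
  lies in \<open>C\<close> or in \<open>A'\<close> according to whether it is adjacent to
  \<open>A\<close>, and neither set meets \<open>U\<close>. This puts (b) into a form suited to
  induction on time.\<close>

lemma partite_open_nbhds:
  assumes AB: "partite_sets (G \<restriction> U) A B"
  shows "A \<union> (open_nbhd G B - closed_nbhd G A) \<union> (open_nbhd G A \<inter> open_nbhd G B) =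
    A \<union> ((\<Union>b\<in>B. nbhd G b) - U)"
proof -
  have AB': "A \<union> B = U" "A \<inter> B = {}" "\<forall>u\<in>A. nbhd G u \<inter> U \<subseteq> B" "\<forall>u\<in>B. nbhd G u \<inter> U \<subseteq> A"
    using AB by (auto simp: partite_sets_induced_iff)
  show ?thesis
    unfolding closed_nbhd_def open_nbhd_def using AB' by blast
qed

context graph
begin

lemma nbhd_sym: "v \<in> nbhd G u \<longleftrightarrow> u \<in> nbhd G v"
  unfolding nbhd_def using graph_symmetric by blast

lemma nbhd_subset_verts: "nbhd G u \<subseteq> verts G"
  unfolding nbhd_def using adj_in_verts by blast

lemma finite_nbhd: "finite (nbhd G u)"
  using finite_subset[OF nbhd_subset_verts] by simp

lemma not_in_own_nbhd: "u \<notin> nbhd G u"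
  unfolding nbhd_def using adj_not_same by blast

lemma card_nbhd: "card (nbhd G u) = out_degree G u"
proof -
  have "nbhd G u = head G ` out_arcs G u"
    by (auto simp: nbhd_def arcs_ends_conv image_iff)
  moreover have "inj_on (head G) (out_arcs G u)"
    by (auto intro!: inj_onI no_multi_arcs simp: arc_to_ends_def)
  ultimately show ?thesis by (simp add: out_degree_def card_image)
qed

section \<open>Components of the subgraph induced by a vertex set\<close>

context
  fixes S :: "'a set"
  assumes S: "S \<subseteq> verts G"
begin

lemma component_verts_induced:
  "component_verts (G \<restriction> S) = (\<lambda>u. {v. u \<rightarrow>\<^sup>*\<^bsub>G \<restriction> S\<^esub> v}) ` S"
proof -
  interpret GS: sym_digraph "G \<restriction> S"
    using induced_induce[OF S] by (rule induced_graph_imp_graph)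
  show ?thesis using GS.component_verts_eq_reachable by simp
qed

lemma component_subset: "U \<in> component_verts (G \<restriction> S) \<Longrightarrow> U \<subseteq> S"
  unfolding component_verts_induced by (auto elim: reachable_in_vertsE)

lemma component_exists:
  assumes "u \<in> S"
  obtains U where "U \<in> component_verts (G \<restriction> S)" "u \<in> U"
proof -
  interpret GS: wf_digraph "G \<restriction> S" by (rule wellformed_induce_subgraph)
  show ?thesis
    using assms by (intro that[of "{v. u \<rightarrow>\<^sup>*\<^bsub>G \<restriction> S\<^esub> v}"]) (auto simp: component_verts_induced)
qed

lemma component_nbhd_closed:
  assumes "U \<in> component_verts (G \<restriction> S)" "u \<in> U" "v \<in> nbhd G u" "v \<in> S"
  shows "v \<in> U"
proof -
  interpret GS: wf_digraph "G \<restriction> S" by (rule wellformed_induce_subgraph)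
  obtain x where U: "U = {v. x \<rightarrow>\<^sup>*\<^bsub>G \<restriction> S\<^esub> v}"
    using assms(1) unfolding component_verts_induced by blast
  have "u \<rightarrow>\<^bsub>G \<restriction> S\<^esub> v"
    using assms component_subset by (auto simp: dominates_induce_subgraph_iff)
  then show ?thesis using assms(2) U GS.reachable_adj_trans by blast
qed

text \<open>A path in the component starting in \<open>D\<close> never leaves \<open>D\<close>.
  Applied to sets defined by activity, this spreads a property of one vertex to the whole
  component.\<close>

lemma component_eqI:
  assumes U: "U \<in> component_verts (G \<restriction> S)"
    and D: "D \<subseteq> U" "D \<noteq> {}" and cl: "\<And>u. u \<in> D \<Longrightarrow> nbhd G u \<inter> U \<subseteq> D"
  shows "D = U"
proof -
  interpret GS: sym_digraph "G \<restriction> S"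
    using induced_induce[OF S] by (rule induced_graph_imp_graph)
  obtain x where x: "U = {v. x \<rightarrow>\<^sup>*\<^bsub>G \<restriction> S\<^esub> v}"
    using U unfolding component_verts_induced by blast
  obtain d where d: "d \<in> D" using D by blast
  have "v \<in> D" if "v \<in> U" for v
  proof -
    have "d \<rightarrow>\<^sup>*\<^bsub>G \<restriction> S\<^esub> v"
      using that d D x GS.symmetric_reachable' GS.reachable_trans by blast
    then show ?thesis
    proof (induction rule: GS.reachable_induct)
      case base then show ?case using d by simp
    next
      case (step a b)
      then have "b \<in> nbhd G a" "b \<in> S" by (auto simp: dominates_induce_subgraph_iff)
      moreover from this have "b \<in> U" using step D component_nbhd_closed[OF U] by blast
      ultimately show ?case using cl[OF step(3)] by blast
    qed
  qed
  then show ?thesis using D by blast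
qed

lemma component_nbhd_nonempty:
  assumes U: "U \<in> component_verts (G \<restriction> S)" and "card U \<ge> 2" "u \<in> U"
  shows "nbhd G u \<inter> U \<noteq> {}"
proof
  assume "nbhd G u \<inter> U = {}"
  then have "{u} = U" using component_eqI[OF U, of "{u}"] assms by auto
  then show False using \<open>card U \<ge> 2\<close> by auto
qed

end

end

section \<open>The activation process\<close>

text \<open>Steps of length 2 from \<open>s\<close> and from \<open>t\<close> together reach every
  time from \<open>max s t\<close> on.\<close>

lemma eventually_if_both_parities:
  assumes step: "\<And>t. P t \<Longrightarrow> P (t + 2)" and "P s" "P t" "even s \<noteq> even (t::nat)"
  shows "eventually P sequentially"
proof -
  have persist: "P (r + 2 * k)" if "P r" for r k
    using that by (induction k) (use step in fastforce)+
  have "P n" if n: "n \<ge> max s t" for n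
  proof (cases "even n = even s")
    case True
    then have "n = s + 2 * ((n - s) div 2)" using n by presburger
    then show ?thesis using persist[OF \<open>P s\<close>] by metis
  next
    case False
    then have "n = t + 2 * ((n - t) div 2)" using n \<open>even s \<noteq> even t\<close> by presburger
    then show ?thesis using persist[OF \<open>P t\<close>] by metis
  qed
  then show ?thesis unfolding eventually_sequentially by blast
qed

locale threshold_graph = graph G for G :: "('a,'b) pre_digraph" +
  fixes \<tau> :: "'a \<Rightarrow> nat" and X :: "'a set"
  assumes tau_values: "u \<in> verts G \<Longrightarrow> \<tau> u \<in> {0, 1, out_degree G u}"
    and full_independent:
      "\<not> (\<exists>u v. u \<rightarrow>\<^bsub>G\<^esub> v \<and> \<tau> u = out_degree G u \<and> \<tau> v = out_degree G v)"
    and X_subset: "X \<subseteq> verts G"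
begin

abbreviation act :: "nat \<Rightarrow> 'a set" where
  "act \<equiv> activation G \<tau> X"

abbreviation full :: "'a \<Rightarrow> bool" where
  "full u \<equiv> \<tau> u = out_degree G u"

text \<open>Not the complement of \<open>full\<close>: a leaf with threshold 1 and an isolated
  vertex with threshold 0 are both \<open>low\<close> and \<open>full\<close>.\<close>

definition low :: "'a set" where
  "low = {u \<in> verts G. \<tau> u \<in> {0, 1}}"

lemma low_subset: "low \<subseteq> verts G"
  by (auto simp: low_def)

lemma full_nbhd_low: "full u \<Longrightarrow> nbhd G u \<subseteq> low"
  using tau_values full_independent nbhd_subset_verts by (fastforce simp: nbhd_def low_def)

lemma not_low_full: "u \<in> verts G \<Longrightarrow> u \<notin> low \<Longrightarrow> full u"
  using tau_values[of u] by (auto simp: low_def)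

lemma eventually_act_SucD:
  assumes "\<forall>\<^sub>F t in sequentially. u \<in> act (Suc t)"
  shows "\<forall>\<^sub>F t in sequentially. u \<in> act t"
  using assms by (subst (asm) eventually_sequentially_Suc[of "\<lambda>t. u \<in> act t"])

section \<open>Activation in one step\<close>

lemma act_Suc_one:
  assumes "u \<in> verts G" "\<tau> u = 1"
  shows "u \<in> act (Suc t) \<longleftrightarrow> nbhd G u \<inter> act t \<noteq> {}"
  using assms finite_nbhd[of u] by (simp add: Suc_le_eq card_gt_0_iff)

lemma act_Suc_low:
  assumes "u \<in> low" "v \<in> nbhd G u" "v \<in> act t"
  shows "u \<in> act (Suc t)"
proof (cases "\<tau> u = 0")
  case False
  then show ?thesis using assms act_Suc_one[of u t] by (auto simp: low_def)
qed (use assms in \<open>auto simp: low_def\<close>)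

lemma act_Suc_full:
  assumes "u \<in> verts G" "full u"
  shows "u \<in> act (Suc t) \<longleftrightarrow> nbhd G u \<subseteq> act t"
proof -
  have "card (nbhd G u) \<le> card (nbhd G u \<inter> act t) \<longleftrightarrow> nbhd G u \<inter> act t = nbhd G u"
    using finite_nbhd[of u] by (metis card_seteq inf_le1 order_refl)
  then show ?thesis using assms by (auto simp: card_nbhd)
qed

text \<open>The neighbours of a full vertex are \<open>low\<close>, so its activity makes all of
  them active one step later, and these reactivate it.\<close>

lemma full_act_period:
  assumes "u \<in> verts G" "full u" "u \<in> act t"
  shows "u \<in> act (t + 2)"
proof -
  have "nbhd G u \<subseteq> act (Suc t)"
    using full_nbhd_low[OF \<open>full u\<close>] assms act_Suc_low nbhd_sym by blast
  then show ?thesis using act_Suc_full[OF assms(1,2), of "Suc t"] by simp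
qed

text \<open>Finiteness of the vertex set yields a common time from which all vertices stay active,
  so each vertex can be treated separately.\<close>

lemma target_set_iff:
  "non_monotone_target_set G \<tau> X \<longleftrightarrow> (\<forall>u\<in>verts G. \<forall>\<^sub>F t in sequentially. u \<in> act t)"
proof -
  have sub: "act t \<subseteq> verts G" for t
    using X_subset by (cases t) auto
  have "non_monotone_target_set G \<tau> X \<longleftrightarrow> (\<forall>\<^sub>F t in sequentially. act t = verts G)"
    using X_subset by (simp add: non_monotone_target_set_def eventually_sequentially)
  also have "\<dots> \<longleftrightarrow> (\<forall>\<^sub>F t in sequentially. \<forall>u\<in>verts G. u \<in> act t)"
  proof -
    have "act t = verts G \<longleftrightarrow> (\<forall>u\<in>verts G. u \<in> act t)" for t
      using sub[of t] by blast
    then show ?thesis by simp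
  qed
  also have "\<dots> \<longleftrightarrow> (\<forall>u\<in>verts G. \<forall>\<^sub>F t in sequentially. u \<in> act t)"
    by (rule eventually_ball_finite_distrib) simp
  finally show ?thesis .
qed

text \<open>A vertex outside \<open>low\<close> is full with all neighbours in \<open>low\<close>;
  once these stay active, so does it one step later.\<close>

lemma target_set_iff_low:
  "non_monotone_target_set G \<tau> X \<longleftrightarrow> (\<forall>u\<in>low. \<forall>\<^sub>F t in sequentially. u \<in> act t)"
proof
  assume low: "\<forall>u\<in>low. \<forall>\<^sub>F t in sequentially. u \<in> act t"
  have "\<forall>\<^sub>F t in sequentially. u \<in> act t" if u: "u \<in> verts G" for u
  proof (cases "u \<in> low")
    case False
    then have full: "full u" using u by (simp add: not_low_full)
    have "\<forall>\<^sub>F t in sequentially. \<forall>v\<in>nbhd G u. v \<in> act t"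
      using low full_nbhd_low[OF full] finite_nbhd by (auto intro!: eventually_ball_finite)
    then have "\<forall>\<^sub>F t in sequentially. u \<in> act (Suc t)"
      by (rule eventually_mono) (use act_Suc_full[OF u full] in blast)
    then show ?thesis by (rule eventually_act_SucD)
  qed (use low in blast)
  then show "non_monotone_target_set G \<tau> X" unfolding target_set_iff by blast
qed (use low_subset target_set_iff in blast)

section \<open>Sufficiency: eventual activity in each kind of component\<close>

lemma eventually_act_component_zero:
  assumes U: "U \<in> component_verts (G \<restriction> low)" and z: "z \<in> U" "\<tau> z = 0" and u: "u \<in> U"
  shows "\<forall>\<^sub>F t in sequentially. u \<in> act t"
proof -
  have sub: "U \<subseteq> low" using component_subset[OF low_subset U] .
  \<comment> \<open>\<open>D\<close> contains \<open>z\<close>, which is active at every positive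
    time, and is closed under neighbours in \<open>U\<close>, so it is all of
    \<open>U\<close>.\<close>
  define D where "D = {u \<in> U. \<forall>\<^sub>F t in sequentially. u \<in> act t}"
  have "\<forall>\<^sub>F t in sequentially. z \<in> act (Suc t)"
    using z sub low_subset by auto
  then have "z \<in> D" using z eventually_act_SucD unfolding D_def by blast
  moreover have "nbhd G a \<inter> U \<subseteq> D" if a: "a \<in> D" for a
  proof
    fix b assume b: "b \<in> nbhd G a \<inter> U"
    have "\<forall>\<^sub>F t in sequentially. a \<in> act t" using a by (simp add: D_def)
    then have "\<forall>\<^sub>F t in sequentially. b \<in> act (Suc t)"
      by (rule eventually_mono) (use b sub act_Suc_low nbhd_sym in blast)
    then show "b \<in> D" using b eventually_act_SucD unfolding D_def by blast
  qed
  ultimately have "D = U" by (intro component_eqI[OF low_subset U]) (auto simp: D_def)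
  then show ?thesis using u by (auto simp: D_def)
qed

text \<open>
  The hypothesis \<open>cond\<close> is vacuous if \<open>U\<close> is not bipartite, so both cases of condition (1) lead here.
\<close>
lemma eventually_act_component_one:
  assumes U: "U \<in> component_verts (G \<restriction> low)" and card: "card U \<ge> 2"
    and meet: "X \<inter> closed_nbhd G U \<noteq> {}"
    and cond: "\<And>A B. partite_sets (G \<restriction> U) A B \<Longrightarrow> X \<inter> (B \<union> (\<Union>a\<in>A. nbhd G a)) \<noteq> {}"
    and u: "u \<in> U"
  shows "\<forall>\<^sub>F t in sequentially. u \<in> act t"
proof -
  have sub: "U \<subseteq> low" using component_subset[OF low_subset U] .
  have spread: "b \<in> act (Suc t)" if "a \<in> act t" "b \<in> nbhd G a" "b \<in> U" for a b t
    using that sub act_Suc_low nbhd_sym by blast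
  \<comment> \<open>Activity passes to a neighbour in \<open>U\<close> and comes back.\<close>
  have period: "a \<in> act (t + 2)" if a: "a \<in> U" "a \<in> act t" for a t
  proof -
    obtain b where "b \<in> nbhd G a" "b \<in> U"
      using component_nbhd_nonempty[OF low_subset U card a(1)] by blast
    then show ?thesis using spread[of a t b] spread[of b "Suc t" a] a nbhd_sym by auto
  qed
  \<comment> \<open>Neighbours in \<open>U\<close> of a vertex of \<open>P\<close> lie in
    \<open>Q\<close> and vice versa, so both \<open>P \<union> Q\<close> and
    \<open>P \<inter> Q\<close> are closed under neighbours in \<open>U\<close>.\<close>
  define P where "P = {a \<in> U. \<exists>t. even t \<and> a \<in> act t}"
  define Q where "Q = {a \<in> U. \<exists>t. odd t \<and> a \<in> act t}"
  have PQ_sub: "P \<subseteq> U" "Q \<subseteq> U"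
    by (auto simp: P_def Q_def)
  have PQ: "nbhd G a \<inter> U \<subseteq> Q" if a: "a \<in> P" for a
  proof
    fix b assume b: "b \<in> nbhd G a \<inter> U"
    obtain t where "even t" "a \<in> act t" using a by (auto simp: P_def)
    then have "odd (Suc t)" "b \<in> act (Suc t)" using b spread by auto
    then show "b \<in> Q" using b unfolding Q_def by blast
  qed
  have QP: "nbhd G a \<inter> U \<subseteq> P" if a: "a \<in> Q" for a
  proof
    fix b assume b: "b \<in> nbhd G a \<inter> U"
    obtain t where "odd t" "a \<in> act t" using a by (auto simp: Q_def)
    then have "even (Suc t)" "b \<in> act (Suc t)" using b spread by auto
    then show "b \<in> P" using b unfolding P_def by blast
  qed
  have "P \<inter> Q \<noteq> {}"
  proof
    assume disj: "P \<inter> Q = {}"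
    \<comment> \<open>A vertex of \<open>X\<close> in \<open>U\<close> is active at time 0; one
      adjacent to \<open>U\<close> activates a vertex of \<open>U\<close> at time 1.\<close>
    obtain x where x: "x \<in> X" "x \<in> U \<or> (\<exists>a\<in>U. x \<in> nbhd G a)"
      using meet by (auto simp: closed_nbhd_eq)
    have "P \<union> Q \<noteq> {}"
    proof (cases "x \<in> U")
      case True
      then have "x \<in> P" using x by (auto simp: P_def intro!: exI[of _ 0])
      then show ?thesis by blast
    next
      case False
      then obtain a where "a \<in> U" "a \<in> nbhd G x" using x nbhd_sym by blast
      then have "a \<in> Q" using x spread[of x 0 a] by (auto simp: Q_def intro!: exI[of _ 1])
      then show ?thesis by blast
    qed
    then have "P \<union> Q = U"
      using PQ QP PQ_sub by (intro component_eqI[OF low_subset U]) blast+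
    then have "partite_sets (G \<restriction> U) P Q"
      unfolding partite_sets_induced_iff using disj PQ QP by blast
    \<comment> \<open>Activity of \<open>y\<close> at time 0 has the wrong parity: either
      \<open>y\<close> itself is in \<open>Q\<close>, or it makes a vertex of \<open>P\<close>
      active at time 1.\<close>
    then obtain y where y: "y \<in> X" "y \<in> Q \<or> (\<exists>a\<in>P. y \<in> nbhd G a)" using cond by blast
    have y0: "y \<in> act 0" using y by simp
    show False
    proof (cases "y \<in> Q")
      case True
      then have "y \<in> P" using y0 unfolding P_def Q_def by blast
      then show False using True disj by blast
    next
      case False
      then obtain a where a: "a \<in> P" "a \<in> nbhd G y" using y nbhd_sym by blast
      then have "a \<in> act 1" using spread[OF y0, of a] by (auto simp: P_def)
      then have "a \<in> Q" using a by (auto simp: P_def Q_def intro!: exI[of _ 1])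
      then show False using a disj by blast
    qed
  qed
  then have "P \<inter> Q = U"
    using PQ QP PQ_sub by (intro component_eqI[OF low_subset U]) blast+
  then have "u \<in> P" "u \<in> Q" using u by blast+
  then obtain s t where "even s" "u \<in> act s" "odd t" "u \<in> act t"
    by (auto simp: P_def Q_def)
  then show ?thesis
    using eventually_if_both_parities[of "\<lambda>t. u \<in> act t" s t] period[OF u] by blast
qed

text \<open>\<open>v1\<close> is active at time 0, and the full vertex \<open>v2\<close> at time 1,
  its whole neighbourhood being in \<open>X\<close>. Since full vertices recur with period 2,
  \<open>u\<close> has an active neighbour at all large times.\<close>

lemma eventually_act_full_nbhd:
  assumes u: "u \<in> low" and full: "\<And>v. v \<in> nbhd G u \<Longrightarrow> full v"
    and v1: "v1 \<in> nbhd G u" "v1 \<in> X" and v2: "v2 \<in> nbhd G u" "nbhd G v2 \<subseteq> X"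
  shows "\<forall>\<^sub>F t in sequentially. u \<in> act t"
proof -
  have "\<forall>\<^sub>F t in sequentially. nbhd G u \<inter> act t \<noteq> {}"
  proof (rule eventually_if_both_parities)
    show "nbhd G u \<inter> act 0 \<noteq> {}" using v1 by auto
    show "nbhd G u \<inter> act 1 \<noteq> {}"
      using v2 act_Suc_full[of v2 0] full nbhd_subset_verts by fastforce
    show "nbhd G u \<inter> act (t + 2) \<noteq> {}" if "nbhd G u \<inter> act t \<noteq> {}" for t
      using that full_act_period full nbhd_subset_verts by blast
  qed simp
  then have "\<forall>\<^sub>F t in sequentially. u \<in> act (Suc t)"
    by (rule eventually_mono) (use u act_Suc_low in blast)
  then show ?thesis by (rule eventually_act_SucD)
qed

section \<open>Necessity: regions that stay inactive\<close>

lemma act_closed_nbhd_disjoint: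
  assumes U: "U \<in> component_verts (G \<restriction> low)" and one: "\<And>u. u \<in> U \<Longrightarrow> \<tau> u = 1"
    and disj: "X \<inter> closed_nbhd G U = {}"
  shows "act t \<inter> closed_nbhd G U = {}"
proof (induction t)
  case 0
  then show ?case using disj by simp
next
  case (Suc t)
  have sub: "U \<subseteq> verts G" using component_subset[OF low_subset U] low_subset by blast
  have inner: "u \<notin> act (Suc t)" if "u \<in> U" for u
    using that Suc act_Suc_one[of u t] one sub by (auto simp: closed_nbhd_eq)
  \<comment> \<open>A neighbour outside \<open>U\<close> is not \<open>low\<close>, or the component
    would contain it; being full, it waits for its inactive neighbour in \<open>U\<close>.\<close>
  have outer: "v \<notin> act (Suc t)" if v: "u \<in> U" "v \<in> nbhd G u" "v \<notin> U" for u v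
  proof -
    have V: "v \<in> verts G" using v nbhd_subset_verts by blast
    then have "full v" using not_low_full v component_nbhd_closed[OF low_subset U] by blast
    then show ?thesis
      using act_Suc_full[OF V, of t] Suc v nbhd_sym by (auto simp: closed_nbhd_eq)
  qed
  show ?case using inner outer unfolding closed_nbhd_eq by blast
qed

text \<open>
  In the notation of the theorem, the two sets are \<open>A \<union> A' \<union> C\<close> and \<open>B \<union> B' \<union> C\<close>.
\<close>
lemma act_partite_alternates:
  assumes U: "U \<in> component_verts (G \<restriction> low)" and one: "\<And>u. u \<in> U \<Longrightarrow> \<tau> u = 1"
    and AB: "partite_sets (G \<restriction> U) A B"
    and disj: "act t \<inter> (A \<union> ((\<Union>b\<in>B. nbhd G b) - U)) = {}"
  shows "act (Suc t) \<inter> (B \<union> ((\<Union>a\<in>A. nbhd G a) - U)) = {}"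
proof -
  have sub: "U \<subseteq> verts G" using component_subset[OF low_subset U] low_subset by blast
  have AB': "A \<union> B = U" "\<forall>u\<in>B. nbhd G u \<inter> U \<subseteq> A"
    using AB by (auto simp: partite_sets_induced_iff)
  have inner: "b \<notin> act (Suc t)" if "b \<in> B" for b
  proof -
    have "nbhd G b \<subseteq> A \<union> ((\<Union>b\<in>B. nbhd G b) - U)" using that AB' by blast
    moreover have "b \<in> verts G" "\<tau> b = 1" using that AB' sub one by blast+
    ultimately show ?thesis using act_Suc_one[of b t] disj by blast
  qed
  \<comment> \<open>Such a \<open>v\<close> is full and adjacent to \<open>a \<in> A\<close>, which
    is inactive at time \<open>t\<close>.\<close>
  have outer: "v \<notin> act (Suc t)" if v: "a \<in> A" "v \<in> nbhd G a" "v \<notin> U" for a v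
  proof -
    have V: "v \<in> verts G" using v nbhd_subset_verts by blast
    have "full v" using not_low_full[OF V] v AB' component_nbhd_closed[OF low_subset U] by blast
    then show ?thesis using act_Suc_full[OF V, of t] disj v nbhd_sym by blast
  qed
  show ?thesis using inner outer by blast
qed

text \<open>Two alternating steps, the second with \<open>A\<close> and \<open>B\<close> exchanged,
  restore the hypothesis on \<open>X\<close>, so it carries over to all even times.\<close>

lemma act_partite_disjoint:
  assumes U: "U \<in> component_verts (G \<restriction> low)" and one: "\<And>u. u \<in> U \<Longrightarrow> \<tau> u = 1"
    and AB: "partite_sets (G \<restriction> U) A B"
    and disj: "X \<inter> (A \<union> ((\<Union>b\<in>B. nbhd G b) - U)) = {}"
  shows "act (2 * k) \<inter> A = {}"
proof -
  have BA: "partite_sets (G \<restriction> U) B A"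
    using AB unfolding partite_sets_induced_iff by blast
  have "act (2 * k) \<inter> (A \<union> ((\<Union>b\<in>B. nbhd G b) - U)) = {}"
  proof (induction k)
    case 0
    then show ?case using disj by simp
  next
    case (Suc k)
    have "act (Suc (Suc (2 * k))) \<inter> (A \<union> ((\<Union>b\<in>B. nbhd G b) - U)) = {}"
      by (rule act_partite_alternates[OF U one BA act_partite_alternates[OF U one AB Suc]])
    then show ?case by (simp del: activation.simps)
  qed
  then show ?thesis by blast
qed

text \<open>Otherwise \<open>B = U\<close> would have no inner edges, whereas in a component with at
  least two vertices every vertex has a neighbour.\<close>

lemma partite_set_nonempty:
  assumes U: "U \<in> component_verts (G \<restriction> low)" "card U \<ge> 2" and AB: "partite_sets (G \<restriction> U) A B"
  shows "A \<noteq> {}"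
proof
  assume "A = {}"
  then have "B = U" "\<forall>u\<in>B. nbhd G u \<inter> U = {}" using AB by (auto simp: partite_sets_induced_iff)
  moreover have "U \<noteq> {}" using U(2) by auto
  ultimately show False using component_nbhd_nonempty[OF low_subset U] by blast
qed

end

section \<open>The characterization\<close>

theorem theorem2:
  fixes G :: "('a,'b) pre_digraph" and \<tau> :: "'a \<Rightarrow> nat" and X :: "'a set"
  assumes "graph G"
    and "\<And>u. u \<in> verts G \<Longrightarrow> \<tau> u \<le> out_degree G u"
    and "\<And>u. u \<in> verts G \<Longrightarrow> \<tau> u \<in> {0, 1, out_degree G u}"
    and "\<not> (\<exists>u v. u \<rightarrow>\<^bsub>G\<^esub> v \<and> \<tau> u = out_degree G u \<and> \<tau> v = out_degree G v)"
    and "X \<subseteq> verts G"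
  shows "non_monotone_target_set G \<tau> X \<longleftrightarrow>
    (\<forall>U \<in> component_verts (G \<restriction> {u \<in> verts G. \<tau> u \<in> {0, 1}}).
       card U \<ge> 2 \<and> (\<forall>u\<in>U. \<tau> u = 1) \<longrightarrow>
         (\<not> bipartite (G \<restriction> U) \<longrightarrow> X \<inter> closed_nbhd G U \<noteq> {}) \<and>
         (\<forall>A B. partite_sets (G \<restriction> U) A B \<longrightarrow>
            (let A' = open_nbhd G B - closed_nbhd G A;
                 B' = open_nbhd G A - closed_nbhd G B;
                 C = open_nbhd G A \<inter> open_nbhd G B
             in X \<inter> (A \<union> A' \<union> C) \<noteq> {} \<and> X \<inter> (B \<union> B' \<union> C) \<noteq> {}))) \<and>
    (\<forall>u \<in> verts G. \<tau> u = 1 \<and> (\<forall>v \<in> nbhd G u. \<tau> v = out_degree G v) \<longrightarrow>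
       (\<exists>v\<^sub>1 \<in> nbhd G u. \<exists>v\<^sub>2 \<in> nbhd G u. v\<^sub>1 \<in> X \<and> nbhd G v\<^sub>2 \<subseteq> X))"
proof -
  interpret threshold_graph G \<tau> X
    using assms by (auto simp: threshold_graph_def threshold_graph_axioms_def)
  \<comment> \<open>The two halves of (b) are \<open>?meet A B\<close> and \<open>?meet B A\<close>,
    since \<open>C\<close> is symmetric in \<open>A\<close> and \<open>B\<close>.\<close>
  let ?meet = "\<lambda>A B. X \<inter> (A \<union> (open_nbhd G B - closed_nbhd G A) \<union>
    (open_nbhd G A \<inter> open_nbhd G B)) \<noteq> {}"
  have swap: "open_nbhd G B \<inter> open_nbhd G A = open_nbhd G A \<inter> open_nbhd G B" for A B
    by blast
  have partite_swap: "partite_sets H B A \<longleftrightarrow> partite_sets H A B" for H :: "('a,'b) pre_digraph" and A B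
    unfolding partite_sets_def by blast
  define cond1 where "cond1 = (\<lambda>U. (\<not> bipartite (G \<restriction> U) \<longrightarrow> X \<inter> closed_nbhd G U \<noteq> {}) \<and>
    (\<forall>A B. partite_sets (G \<restriction> U) A B \<longrightarrow> ?meet A B \<and> ?meet B A))"
  define cond2 where "cond2 = (\<lambda>u. \<exists>v\<^sub>1 \<in> nbhd G u. \<exists>v\<^sub>2 \<in> nbhd G u. v\<^sub>1 \<in> X \<and> nbhd G v\<^sub>2 \<subseteq> X)"
  let ?rhs = "(\<forall>U \<in> component_verts (G \<restriction> low). card U \<ge> 2 \<and> (\<forall>u\<in>U. \<tau> u = 1) \<longrightarrow> cond1 U) \<and>
    (\<forall>u \<in> verts G. \<tau> u = 1 \<and> (\<forall>v \<in> nbhd G u. full v) \<longrightarrow> cond2 u)"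
  have "non_monotone_target_set G \<tau> X \<longleftrightarrow> ?rhs"
  proof
    assume "non_monotone_target_set G \<tau> X"
    then obtain T where T: "\<And>t. t \<ge> T \<Longrightarrow> act t = verts G"
      unfolding non_monotone_target_set_def by blast
    show ?rhs
    proof (intro conjI ballI impI; elim conjE)
      fix U assume U: "U \<in> component_verts (G \<restriction> low)" "card U \<ge> 2" and one: "\<forall>u\<in>U. \<tau> u = 1"
      have sub: "U \<subseteq> verts G" using component_subset[OF low_subset U(1)] low_subset by blast
      have "?meet A B" if AB: "partite_sets (G \<restriction> U) A B" for A B
      proof
        assume "X \<inter> (A \<union> (open_nbhd G B - closed_nbhd G A) \<union> (open_nbhd G A \<inter> open_nbhd G B)) = {}"
        then have "X \<inter> (A \<union> ((\<Union>b\<in>B. nbhd G b) - U)) = {}"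
          using partite_open_nbhds[OF AB] by simp
        \<comment> \<open>The time \<open>2 * T\<close> is even and not before \<open>T\<close>, so
          the nonempty set \<open>A\<close> would have to be active.\<close>
        then have "act (2 * T) \<inter> A = {}"
          using U(1) one AB by (intro act_partite_disjoint) auto
        moreover have "A \<subseteq> verts G" using AB sub by (auto simp: partite_sets_induced_iff)
        ultimately show False using T[of "2 * T"] partite_set_nonempty[OF U AB] by auto
      qed
      moreover have "X \<inter> closed_nbhd G U \<noteq> {}"
      proof
        assume "X \<inter> closed_nbhd G U = {}"
        then have "act T \<inter> closed_nbhd G U = {}"
          using U(1) one by (intro act_closed_nbhd_disjoint) auto
        then have "U = {}" using T[of T] sub by (auto simp: closed_nbhd_eq)
        then show False using U(2) by simp
      qed
      ultimately show "cond1 U" unfolding cond1_def using partite_swap by blast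
    next
      fix u assume u: "u \<in> verts G" "\<tau> u = 1" and full: "\<forall>v\<in>nbhd G u. full v"
      \<comment> \<open>Activity is traced backwards: a neighbour active at time
        \<open>t + 1\<close> is full, so all of its neighbours, among them \<open>u\<close>, were
        active at time \<open>t\<close>.\<close>
      have step: "u \<in> act t" if "u \<in> act (t + 2)" for t
      proof -
        obtain v where v: "v \<in> nbhd G u" "v \<in> act (Suc t)"
          using \<open>u \<in> act (t + 2)\<close> act_Suc_one[OF u, of "Suc t"] by auto
        then show ?thesis
          using act_Suc_full[of v t] full nbhd_subset_verts nbhd_sym by blast
      qed
      have pull_back: "u \<in> act t" if "u \<in> act (t + 2 * k)" for t k
        using that by (induction k) (use step in fastforce)+
      \<comment> \<open>Time 1 yields \<open>v1\<close> in \<open>X\<close>; time 2 yields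
        \<open>v2\<close> active at time 1, hence with its neighbourhood in
        \<open>X\<close>.\<close>
      have "u \<in> act 1" "u \<in> act 2"
        using pull_back[of 1 T] pull_back[of 2 T] T u by (auto simp del: activation.simps)
      then obtain v1 v2 where v: "v1 \<in> nbhd G u" "v1 \<in> act 0" "v2 \<in> nbhd G u" "v2 \<in> act 1"
        using act_Suc_one[OF u, of 0] act_Suc_one[OF u, of 1]
        by (auto simp del: activation.simps simp: numeral_2_eq_2)
      then have "nbhd G v2 \<subseteq> X"
        using act_Suc_full[of v2 0] full nbhd_subset_verts by fastforce
      then show "cond2 u" unfolding cond2_def using v by auto
    qed
  next
    assume R: ?rhs
    have "\<forall>\<^sub>F t in sequentially. u \<in> act t" if u: "u \<in> low" for u
    proof -
      obtain U where U: "U \<in> component_verts (G \<restriction> low)" "u \<in> U"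
        using component_exists[OF low_subset u] .
      have sub: "U \<subseteq> low" using component_subset[OF low_subset U(1)] .
      \<comment> \<open>A zero threshold drives the whole component; otherwise condition (1) serves
        the larger components and condition (2) the singletons.\<close>
      consider z where "z \<in> U" "\<tau> z = 0" | "\<forall>u\<in>U. \<tau> u = 1" "card U \<ge> 2"
        | "\<forall>u\<in>U. \<tau> u = 1" "card U < 2"
        using sub by (force simp: low_def)
      then show ?thesis
      proof cases
        case 1
        then show ?thesis using eventually_act_component_zero U by blast
      next
        case 2
        then have c: "cond1 U" using R U by blast
        have meet: "X \<inter> (A \<union> ((\<Union>b\<in>B. nbhd G b) - U)) \<noteq> {}" if "partite_sets (G \<restriction> U) A B" for A B
          using c that partite_open_nbhds[OF that] unfolding cond1_def by metis
        show ?thesis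
        proof (rule eventually_act_component_one[OF U(1) 2(2) _ _ U(2)])
          \<comment> \<open>In the bipartite case this follows from (b), as \<open>A\<close> and the
            neighbours of \<open>B\<close> lie in the closed neighbourhood of
            \<open>U\<close>.\<close>
          show "X \<inter> closed_nbhd G U \<noteq> {}"
          proof (cases "bipartite (G \<restriction> U)")
            case True
            then obtain A B where AB: "partite_sets (G \<restriction> U) A B" unfolding bipartite_def by blast
            then have "A \<subseteq> U" "B \<subseteq> U" by (auto simp: partite_sets_induced_iff)
            then show ?thesis using meet[OF AB] unfolding closed_nbhd_eq by blast
          qed (use c in \<open>simp add: cond1_def\<close>)
          show "X \<inter> (B \<union> (\<Union>a\<in>A. nbhd G a)) \<noteq> {}" if "partite_sets (G \<restriction> U) A B" for A B
            using meet[of B A] that partite_swap by blast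
        qed
      next
        case 3
        have "finite U" using sub low_subset finite_verts by (meson finite_subset)
        then have "U = {u}" using 3 U(2) card_le_Suc0_iff_eq[of U] by auto
        \<comment> \<open>A \<open>low\<close> neighbour would belong to the component, which is
          only \<open>{u}\<close>.\<close>
        then have full: "full v" if "v \<in> nbhd G u" for v
          using that component_nbhd_closed[OF low_subset U] not_low_full nbhd_subset_verts
            not_in_own_nbhd by blast
        then have "cond2 u" using R u low_subset 3 U by blast
        then show ?thesis
          unfolding cond2_def using eventually_act_full_nbhd[OF u full] by blast
      qed
    qed
    then show "non_monotone_target_set G \<tau> X" unfolding target_set_iff_low by blast
  qed
  then show ?thesis
    unfolding cond1_def cond2_def low_def Let_def swap by (simp add: Un_commute Int_commute)
qed

end
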